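(* For all $k,m>0$ with $k+m<1$, the function $$(p,q)\mapsto\log\frac{|p-q|}{|pq|^{k}\,|(p-1)(q-1)|^{m}},\qquad p,q\in\mathbb C\setminus\{0,1\},\ p\neq q,$$ is an Evans kernel on $\mathbb C\setminus\{0,1\}$.
   Context: Let $\Sigma$ be an open Riemann surface and $q\in\Sigma$. An Evans-Selberg potential on $\Sigma$ with pole $q$ is a real-valued function $E_q(p)$ such that: (i) $E_q(p)$ is harmonic in $p$ on $\Sigma\setminus\{q\}$; (ii) $E_q(p)-\log|\varphi(p)-\varphi(q)|$ is bounded near $q$, where $\varphi$ is a local coordinate; (iii) $E_q(p)\to+\infty$ as $p\to a_\infty$, the Alexandroff ideal boundary point of $\Sigma$ (i.e. the point at infinity of the one-point compactification of $\Sigma$). An Evans kernel on $\Sigma$ is a function $E(p,q)$ such that, for each $q\in\Sigma$, $E_q(p):=E(p,q)$ is an Evans-Selberg potential with pole $q$; $E$ is symmetric in $(p,q)$; and for any pair $(q,q')$ of points of $\Sigma$ the function $p\mapsto E(p,q)-E(p,q')$ is bounded near the boundary (i.e. near the ideal boundary point $a_\infty$). *)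

theory Defs
  imports "HOL-Complex_Analysis.Complex_Analysis"
begin

section \<open>Riemann surfaces\<close>

text \<open>
  A chart is a pair \<open>(U, \<phi>)\<close>; only the values of \<open>\<phi>\<close> on \<open>U\<close> matter, so its inverse is
  \<open>inv_into U \<phi>\<close>.
\<close>

definition complex_chart :: "'a topology \<Rightarrow> 'a set \<Rightarrow> ('a \<Rightarrow> complex) \<Rightarrow> bool"
  where "complex_chart X U \<phi> \<longleftrightarrow>
    openin X U \<and> open (\<phi> ` U) \<and>
    homeomorphic_map (subtopology X U) (top_of_set (\<phi> ` U)) \<phi>"

definition holomorphic_transition ::
    "'a set \<Rightarrow> ('a \<Rightarrow> complex) \<Rightarrow> 'a set \<Rightarrow> ('a \<Rightarrow> complex) \<Rightarrow> bool"
  where "holomorphic_transition U \<phi> V \<psi> \<longleftrightarrow>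
    (\<lambda>z. \<psi> (inv_into U \<phi> z)) holomorphic_on \<phi> ` (U \<inter> V)"

definition complex_atlas :: "'a topology \<Rightarrow> ('a set \<times> ('a \<Rightarrow> complex)) set \<Rightarrow> bool"
  where "complex_atlas X \<A> \<longleftrightarrow>
    topspace X \<subseteq> (\<Union>(U, \<phi>)\<in>\<A>. U) \<and>
    (\<forall>(U, \<phi>)\<in>\<A>. complex_chart X U \<phi>) \<and>
    (\<forall>(U, \<phi>)\<in>\<A>. \<forall>(V, \<psi>)\<in>\<A>. holomorphic_transition U \<phi> V \<psi>)"

text \<open>
  Second countability is not required: by Rado's theorem it follows from the other conditions.
  ``Open'' means non-compact.
\<close>

definition open_riemann_surface :: "'a topology \<Rightarrow> ('a set \<times> ('a \<Rightarrow> complex)) set \<Rightarrow> bool"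
  where "open_riemann_surface X \<A> \<longleftrightarrow>
    connected_space X \<and> Hausdorff_space X \<and> \<not> compact_space X \<and> complex_atlas X \<A>"

text \<open>The local coordinates are the members of the maximal atlas generated by \<open>\<A>\<close>.\<close>

definition local_coordinate ::
    "'a topology \<Rightarrow> ('a set \<times> ('a \<Rightarrow> complex)) set \<Rightarrow> 'a set \<Rightarrow> ('a \<Rightarrow> complex) \<Rightarrow> bool"
  where "local_coordinate X \<A> U \<phi> \<longleftrightarrow>
    complex_chart X U \<phi> \<and>
    (\<forall>(V, \<psi>)\<in>\<A>. holomorphic_transition U \<phi> V \<psi> \<and> holomorphic_transition V \<psi> U \<phi>)"

section \<open>Harmonic functions\<close>

text \<open>
  Twice continuously differentiable with vanishing Laplacian: \<open>ux\<close>, \<open>uy\<close>, \<open>uxx\<close>, \<open>uxy\<close>,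
  \<open>uyx\<close>, \<open>uyy\<close> are the partial derivatives, taken along \<open>1\<close> and \<open>\<i>\<close>.
\<close>

definition has_partials_on ::
    "(complex \<Rightarrow> real) \<Rightarrow> (complex \<Rightarrow> real) \<Rightarrow> (complex \<Rightarrow> real) \<Rightarrow> complex set \<Rightarrow> bool"
  where "has_partials_on u ux uy D \<longleftrightarrow>
    (\<forall>z\<in>D. ((\<lambda>t. u (z + complex_of_real t)) has_real_derivative ux z) (at 0) \<and>
           ((\<lambda>t. u (z + \<i> * complex_of_real t)) has_real_derivative uy z) (at 0)) \<and>
    continuous_on D ux \<and> continuous_on D uy"

definition harmonic_on :: "(complex \<Rightarrow> real) \<Rightarrow> complex set \<Rightarrow> bool"
  where "harmonic_on u D \<longleftrightarrow> open D \<and>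
    (\<exists>ux uy uxx uxy uyx uyy.
      has_partials_on u ux uy D \<and> has_partials_on ux uxx uxy D \<and> has_partials_on uy uyx uyy D \<and>
      (\<forall>z\<in>D. uxx z + uyy z = 0))"

definition surface_harmonic_on ::
    "'a topology \<Rightarrow> ('a set \<times> ('a \<Rightarrow> complex)) set \<Rightarrow> ('a \<Rightarrow> real) \<Rightarrow> 'a set \<Rightarrow> bool"
  where "surface_harmonic_on X \<A> u W \<longleftrightarrow> openin X W \<and>
    (\<forall>U \<phi>. local_coordinate X \<A> U \<phi> \<longrightarrow>
      harmonic_on (\<lambda>z. u (inv_into U \<phi> z)) (\<phi> ` (U \<inter> W)))"

section \<open>Evans-Selberg potentials and Evans kernels\<close>

text \<open>
  The filter of punctured neighbourhoods of the Alexandroff ideal boundary point \<open>None\<close>,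
  transported to the surface itself.
\<close>

definition ideal_boundary :: "'a topology \<Rightarrow> 'a filter"
  where "ideal_boundary X = filtermap the (atin (Alexandroff_compactification X) None)"

definition evans_selberg_potential ::
    "'a topology \<Rightarrow> ('a set \<times> ('a \<Rightarrow> complex)) set \<Rightarrow> 'a \<Rightarrow> ('a \<Rightarrow> real) \<Rightarrow> bool"
  where "evans_selberg_potential X \<A> q e \<longleftrightarrow>
    open_riemann_surface X \<A> \<and> q \<in> topspace X \<and>
    surface_harmonic_on X \<A> e (topspace X - {q}) \<and>
    (\<forall>U \<phi>. local_coordinate X \<A> U \<phi> \<and> q \<in> U \<longrightarrow>
      (\<exists>B. \<forall>\<^sub>F p in atin X q. \<bar>e p - ln (cmod (\<phi> p - \<phi> q))\<bar> \<le> B)) \<and>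
    filterlim e at_top (ideal_boundary X)"

text \<open>
  A kernel is a function of two distinct points, so its values on the diagonal are irrelevant
  and symmetry is required off the diagonal only.
\<close>

definition evans_kernel ::
    "'a topology \<Rightarrow> ('a set \<times> ('a \<Rightarrow> complex)) set \<Rightarrow> ('a \<Rightarrow> 'a \<Rightarrow> real) \<Rightarrow> bool"
  where "evans_kernel X \<A> E \<longleftrightarrow>
    open_riemann_surface X \<A> \<and>
    (\<forall>q\<in>topspace X. evans_selberg_potential X \<A> q (\<lambda>p. E p q)) \<and>
    (\<forall>p\<in>topspace X. \<forall>q\<in>topspace X. p \<noteq> q \<longrightarrow> E p q = E q p) \<and>
    (\<forall>q\<in>topspace X. \<forall>q'\<in>topspace X.
      \<exists>B. \<forall>\<^sub>F p in ideal_boundary X. \<bar>E p q - E p q'\<bar> \<le> B)"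

section \<open>Plane domains as Riemann surfaces\<close>

definition plane_atlas :: "complex set \<Rightarrow> (complex set \<times> (complex \<Rightarrow> complex)) set"
  where "plane_atlas S = {(S, \<lambda>z. z)}"

end

theory Submission
  imports Defs
begin

text \<open>
  Fix a pole \<open>q\<close>. Up to a constant in \<open>p\<close>, the kernel is
  \<open>ln \<bar>p - q\<bar> - k * ln \<bar>p\<bar> - m * ln \<bar>p - 1\<bar>\<close>.

  \<^item> It is harmonic in every local coordinate: a local coordinate \<open>\<phi>\<close> has a holomorphic inverse
    \<open>g\<close>, and in the coordinate the kernel is a real combination of functions \<open>ln \<bar>g - c\<bar>\<close> whose
    arguments do not vanish. Its differential is \<open>h \<mapsto> Re (f * h)\<close> with \<open>f\<close> the corresponding
    combination of the logarithmic derivatives \<open>g' / (g - c)\<close>, and a function with such a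
    differential, \<open>f\<close> holomorphic, is harmonic (\<open>harmonic_on_Re_derivative\<close>).

  \<^item> At \<open>q\<close> only \<open>ln \<bar>p - q\<bar>\<close> is singular, and it differs from \<open>ln \<bar>\<phi> p - \<phi> q\<bar>\<close> by a bounded
    amount since \<open>\<phi>' q \<noteq> 0\<close> (\<open>log_kernel_bounded_at_pole\<close>).

  \<^item> To approach the ideal boundary is to approach \<open>0\<close>, \<open>1\<close> or \<open>\<infinity>\<close>
    (\<open>eventually_ideal_boundary_plane_domain\<close>). The kernel is \<open>- k * ln \<bar>p\<bar> + O(1)\<close> at \<open>0\<close>,
    \<open>- m * ln \<bar>p - 1\<bar> + O(1)\<close> at \<open>1\<close> and \<open>(1 - k - m) * ln \<bar>p\<bar> + O(1)\<close> at \<open>\<infinity>\<close>, so the conditions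
    on \<open>k\<close> and \<open>m\<close> make it tend to \<open>+\<infinity>\<close> in all three cases.

  \<^item> For two poles the terms with \<open>k\<close> and \<open>m\<close> cancel up to a constant, and what remains,
    \<open>ln (\<bar>p - q\<bar> / \<bar>p - q'\<bar>)\<close>, has finite limits at \<open>0\<close>, \<open>1\<close> and \<open>\<infinity>\<close>.
\<close>

section \<open>Harmonic functions as real parts of holomorphic primitives\<close>

lemma has_partials_on_Re_derivative:
  fixes f :: "complex \<Rightarrow> complex"
  assumes u: "\<And>z. z \<in> D \<Longrightarrow> (u has_derivative (\<lambda>h. Re (f z * h))) (at z)"
    and f: "continuous_on D f"
  shows "has_partials_on u (\<lambda>z. Re (f z)) (\<lambda>z. - Im (f z)) D"
proof -
  have *: "((\<lambda>t. u (z + c * complex_of_real t)) has_real_derivative Re (f z * c)) (at 0)"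
    if "z \<in> D" for z c
  proof -
    have "((\<lambda>t. z + c * complex_of_real t) has_derivative (\<lambda>t. c * complex_of_real t)) (at 0)"
      by (auto intro!: derivative_eq_intros)
    moreover have "(u has_derivative (\<lambda>h. Re (f z * h))) (at (z + c * complex_of_real 0))"
      using u[OF that] by simp
    ultimately have "((\<lambda>t. u (z + c * complex_of_real t)) has_derivative
        (\<lambda>t. Re (f z * (c * complex_of_real t)))) (at 0)"
      using has_derivative_compose by blast
    moreover have "(\<lambda>t. Re (f z * (c * complex_of_real t))) = (*) (Re (f z * c))"
      by (auto simp: algebra_simps)
    ultimately show ?thesis
      by (simp add: has_field_derivative_def)
  qed
  show ?thesis
    unfolding has_partials_on_def
    using *[where c = 1] *[where c = "\<i>"]
    by (auto intro!: continuous_intros f)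
qed

text \<open>
  Locally \<open>u\<close> is the real part of a primitive of \<open>f\<close>.
  The real differential \<open>h \<mapsto> Re (f z * h)\<close> has the gradient \<open>(Re f, - Im f)\<close>; for holomorphic
  \<open>f\<close> the Cauchy-Riemann equations then give a vanishing Laplacian.
\<close>

lemma harmonic_on_Re_derivative:
  assumes D: "open D" and f: "f holomorphic_on D"
    and u: "\<And>z. z \<in> D \<Longrightarrow> (u has_derivative (\<lambda>h. Re (f z * h))) (at z)"
  shows "harmonic_on u D"
proof -
  have f': "(f has_derivative (\<lambda>h. deriv f z * h)) (at z)" if "z \<in> D" for z
    using holomorphic_derivI[OF f D that] by (simp add: has_field_derivative_def)
  have cont: "continuous_on D (deriv f)"
    using holomorphic_deriv[OF f D] by (rule holomorphic_on_imp_continuous_on)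
  have 1: "has_partials_on u (\<lambda>z. Re (f z)) (\<lambda>z. - Im (f z)) D"
    by (intro has_partials_on_Re_derivative u holomorphic_on_imp_continuous_on f)
  have 2: "has_partials_on (\<lambda>z. Re (f z)) (\<lambda>z. Re (deriv f z)) (\<lambda>z. - Im (deriv f z)) D"
    by (intro has_partials_on_Re_derivative cont has_derivative_Re f')
  have "((\<lambda>z. - Im (f z)) has_derivative (\<lambda>h. Re (\<i> * deriv f z * h))) (at z)" if "z \<in> D" for z
  proof -
    have "(\<lambda>h. Re (\<i> * deriv f z * h)) = (\<lambda>h. - Im (deriv f z * h))"
      by (auto simp: algebra_simps)
    then show ?thesis
      using has_derivative_minus[OF has_derivative_Im[OF f'[OF that]]] by simp
  qed
  then have "has_partials_on (\<lambda>z. - Im (f z)) (\<lambda>z. Re (\<i> * deriv f z))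
      (\<lambda>z. - Im (\<i> * deriv f z)) D"
    by (rule has_partials_on_Re_derivative) (auto intro!: continuous_intros cont)
  with 1 2 show ?thesis
    unfolding harmonic_on_def using D
    by (intro conjI exI[of _ "\<lambda>z. Re (f z)"] exI[of _ "\<lambda>z. - Im (f z)"]
        exI[of _ "\<lambda>z. Re (deriv f z)"] exI[of _ "\<lambda>z. - Im (deriv f z)"]
        exI[of _ "\<lambda>z. Re (\<i> * deriv f z)"] exI[of _ "\<lambda>z. - Im (\<i> * deriv f z)"]) auto
qed

lemma has_derivative_ln_cmod:
  assumes "(g has_field_derivative g') (at z)" and "g z \<noteq> 0"
  shows "((\<lambda>z. ln (cmod (g z))) has_derivative (\<lambda>h. Re (g' / g z * h))) (at z)"
proof -
  have "(g has_derivative (\<lambda>h. g' * h)) (at z)"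
    using assms(1) by (simp add: has_field_derivative_def)
  then have "((\<lambda>z. cmod (g z)) has_derivative (\<lambda>h. (g' * h) \<bullet> sgn (g z))) (at z)"
    using has_derivative_compose has_derivative_norm[OF assms(2)] by blast
  then have "((\<lambda>z. ln (cmod (g z))) has_derivative
      (\<lambda>h. (g' * h) \<bullet> sgn (g z) * inverse (cmod (g z)))) (at z)"
    using assms(2) by (auto intro!: has_derivative_ln simp: divide_inverse)
  moreover have "(g' * h) \<bullet> sgn (g z) * inverse (cmod (g z)) = Re (g' / g z * h)" for h
  proof -
    have "w \<bullet> sgn v * inverse (cmod v) = Re (w / v)" for w v
      by (simp add: inner_complex_def sgn_div_norm Re_divide flip: cmod_power2)
        (simp add: divide_inverse power2_eq_square algebra_simps)
    then show ?thesis
      by (metis times_divide_eq_left)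
  qed
  ultimately show ?thesis
    by simp
qed

section \<open>Plane domains\<close>

lemma open_riemann_surface_plane_domain:
  assumes "open S" "connected S" "S \<noteq> {}"
  shows "open_riemann_surface (top_of_set S) (plane_atlas S)"
proof -
  have "\<not> compact S"
    using assms compact_open by blast
  moreover have "complex_chart (top_of_set S) S (\<lambda>z. z)"
    using assms(1)
    by (simp add: complex_chart_def homeomorphic_map_id[unfolded id_def] subtopology_subtopology)
  moreover have "holomorphic_transition S (\<lambda>z. z) S (\<lambda>z. z)"
    unfolding holomorphic_transition_def
    by (rule holomorphic_transform[of "\<lambda>z. z"]) (auto simp: inv_into_f_f[of "\<lambda>z. z", simplified])
  ultimately show ?thesis
    using assms unfolding open_riemann_surface_def complex_atlas_def plane_atlas_def
    by (auto simp: Hausdorff_space_subtopology connected_space_subtopology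
        compact_space_subtopology compact_space_def)
qed

text \<open>
  The only chart of the atlas is the identity, so the two transition maps to it are \<open>\<phi>\<close> and its
  inverse.
\<close>

lemma local_coordinate_plane_domain:
  assumes S: "open S" and loc: "local_coordinate (top_of_set S) (plane_atlas S) U \<phi>"
  shows "open U" "U \<subseteq> S" "inj_on \<phi> U" "\<phi> holomorphic_on U"
    "open (\<phi> ` U)" "inv_into U \<phi> holomorphic_on \<phi> ` U"
proof -
  have ch: "complex_chart (top_of_set S) U \<phi>"
    and t1: "holomorphic_transition U \<phi> S (\<lambda>z. z)"
    and t2: "holomorphic_transition S (\<lambda>z. z) U \<phi>"
    using loc by (auto simp: local_coordinate_def plane_atlas_def)
  then show U: "open U" "U \<subseteq> S" and "open (\<phi> ` U)"
    using S by (auto simp: complex_chart_def openin_open_eq)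
  have "homeomorphic_map (subtopology (top_of_set S) U) (top_of_set (\<phi> ` U)) \<phi>"
    using ch by (simp add: complex_chart_def)
  from homeomorphic_imp_injective_map[OF this] show "inj_on \<phi> U"
    using U(2) by (simp add: Int_absorb1)
  have SU: "U \<inter> S = U" "S \<inter> U = U"
    using U(2) by auto
  show "inv_into U \<phi> holomorphic_on \<phi> ` U"
    using t1 SU by (simp add: holomorphic_transition_def)
  have "(\<lambda>z. \<phi> (inv_into S (\<lambda>z. z) z)) holomorphic_on U"
    using t2 SU by (simp add: holomorphic_transition_def)
  then show "\<phi> holomorphic_on U"
    by (rule holomorphic_transform) (use U(2) in \<open>auto simp: inv_into_f_f[of "\<lambda>z. z", simplified]\<close>)
qed

lemma atin_top_of_set_open:
  fixes S :: "'a::topological_space set"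
  assumes "open S" "q \<in> S"
  shows "atin (top_of_set S) q = at q"
proof (rule filter_eqI)
  fix P
  show "eventually P (atin (top_of_set S) q) \<longleftrightarrow> eventually P (at q)"
  proof
    assume "eventually P (atin (top_of_set S) q)"
    then show "eventually P (at q)"
      using assms by (auto simp: eventually_atin eventually_at_topological openin_open_eq)
  next
    assume "eventually P (at q)"
    then obtain T where "open T" "q \<in> T" "\<forall>x\<in>T. x \<noteq> q \<longrightarrow> P x"
      by (auto simp: eventually_at_topological)
    then show "eventually P (atin (top_of_set S) q)"
      using assms by (auto simp: eventually_atin openin_open_eq intro!: exI[of _ "S \<inter> T"])
  qed
qed

text \<open>
  Neighbourhoods of \<open>\<infinity>\<close> and of the points of \<open>F\<close> together cover the complement of a compact
  subset of \<open>UNIV - F\<close>, namely a closed disc from which open neighbourhoods of the points of \<open>F\<close>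
  have been removed.
\<close>

lemma eventually_ideal_boundary_plane_domain:
  fixes F :: "complex set"
  assumes inf: "eventually P at_infinity" and F: "\<And>a. a \<in> F \<Longrightarrow> eventually P (at a)"
  shows "eventually P (ideal_boundary (top_of_set (UNIV - F)))"
proof -
  have "\<exists>T. open T \<and> a \<in> T \<and> (\<forall>x\<in>T. x \<noteq> a \<longrightarrow> P x)" if "a \<in> F" for a
    using F[OF that] by (auto simp: eventually_at_topological)
  then obtain T where T: "\<And>a. a \<in> F \<Longrightarrow> open (T a)" "\<And>a. a \<in> F \<Longrightarrow> a \<in> T a"
      "\<And>a x. a \<in> F \<Longrightarrow> x \<in> T a \<Longrightarrow> x \<noteq> a \<Longrightarrow> P x"
    by metis
  obtain b where b: "\<And>x. b \<le> cmod x \<Longrightarrow> P x"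
    using inf by (auto simp: eventually_at_infinity)
  let ?X = "top_of_set (UNIV - F)"
  define K where "K = cball 0 b - (\<Union>a\<in>F. T a)"
  have K: "compact K" "K \<subseteq> UNIV - F"
    unfolding K_def using T(1,2) by (auto intro!: compact_diff)
  have "compactin ?X K"
    using K by (simp add: compactin_subtopology)
  moreover have "closedin ?X K"
    using K by (intro closedin_subset_topspace) (auto intro: compact_imp_closed)
  ultimately have "openin (Alexandroff_compactification ?X)
      (insert None (Some ` (topspace ?X - K)))"
    by (auto simp: openin_Alexandroff_compactification)
  moreover have "P x" if "x \<in> topspace ?X - K" for x
    using that T(3) b[of x] by (force simp: K_def)
  ultimately show ?thesis
    unfolding ideal_boundary_def eventually_filtermap eventually_atin
    by (intro disjI2 exI[of _ "insert None (Some ` (topspace ?X - K))"]) auto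
qed

section \<open>Limits of logarithms\<close>

lemma tendsto_imp_eventually_bounded:
  fixes f :: "'a \<Rightarrow> real"
  assumes "(f \<longlongrightarrow> l) F"
  shows "eventually (\<lambda>x. \<bar>f x\<bar> \<le> \<bar>l\<bar> + 1) F"
proof -
  have "eventually (\<lambda>x. \<bar>f x\<bar> < \<bar>l\<bar> + 1) F"
    by (rule order_tendstoD(2)[OF tendsto_rabs[OF assms]]) simp
  then show ?thesis
    by (rule eventually_mono) simp
qed

lemma tendsto_ln_cmod_quotient_at_infinity:
  "((\<lambda>p. ln (cmod (p - a)) - ln (cmod (p - b))) \<longlongrightarrow> 0) at_infinity"
proof -
  have "filterlim (\<lambda>p. p - b) at_infinity at_infinity"
    using tendsto_add_filterlim_at_infinity'[OF filterlim_ident tendsto_const, of "- b"]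
    by simp
  then have "((\<lambda>p. 1 + (b - a) / (p - b)) \<longlongrightarrow> 1 + 0) at_infinity"
    by (intro tendsto_intros tendsto_divide_0[OF tendsto_const])
  then have "((\<lambda>p. ln (cmod (1 + (b - a) / (p - b)))) \<longlongrightarrow> ln (cmod 1)) at_infinity"
    by (intro tendsto_ln tendsto_norm) auto
  moreover have "eventually (\<lambda>p. ln (cmod (1 + (b - a) / (p - b))) =
      ln (cmod (p - a)) - ln (cmod (p - b))) at_infinity"
  proof -
    have "eventually (\<lambda>p. p \<noteq> a \<and> p \<noteq> b) at_infinity"
      by (intro eventually_conj eventually_not_equal_at_infinity)
    then show ?thesis
    proof (rule eventually_mono)
      fix p assume "p \<noteq> a \<and> p \<noteq> b"
      moreover from this have "1 + (b - a) / (p - b) = (p - a) / (p - b)"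
        by (simp add: field_simps)
      ultimately show "ln (cmod (1 + (b - a) / (p - b))) = ln (cmod (p - a)) - ln (cmod (p - b))"
        by (simp add: norm_divide ln_div)
    qed
  qed
  ultimately show ?thesis
    by (simp add: tendsto_cong)
qed

lemma filterlim_ln_cmod_at_infinity: "filterlim (\<lambda>p::complex. ln (cmod p)) at_top at_infinity"
  using filterlim_compose[OF ln_at_top filterlim_norm_at_top] .

lemma filterlim_ln_cmod_at: "filterlim (\<lambda>p. ln (cmod (p - a))) at_bot (at a)"
proof -
  have "filterlim (\<lambda>p. cmod (p - a)) (at_right 0) (at a)"
    unfolding filterlim_at
    by (auto intro!: tendsto_eq_intros simp: eventually_at_filter)
  then show ?thesis
    by (rule filterlim_compose[OF ln_at_0])
qed

text \<open>
  An injective holomorphic \<open>\<phi>\<close> has \<open>\<phi>' q \<noteq> 0\<close>, so \<open>p - q\<close> and \<open>\<phi> p - \<phi> q\<close> are comparable near \<open>q\<close>.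
\<close>

lemma tendsto_ln_cmod_diff_coordinate:
  assumes U: "open U" "q \<in> U" and \<phi>: "\<phi> holomorphic_on U" "inj_on \<phi> U"
  shows "((\<lambda>p. ln (cmod (p - q)) - ln (cmod (\<phi> p - \<phi> q))) \<longlongrightarrow> - ln (cmod (deriv \<phi> q))) (at q)"
proof -
  have "deriv \<phi> q \<noteq> 0"
    using holomorphic_injective_imp_regular[OF \<phi>(1) U(1) \<phi>(2) U(2)] .
  moreover have "((\<lambda>p. (\<phi> p - \<phi> q) / (p - q)) \<longlongrightarrow> deriv \<phi> q) (at q)"
    using holomorphic_derivI[OF \<phi>(1) U] by (simp add: has_field_derivative_iff)
  ultimately have "((\<lambda>p. - ln (cmod ((\<phi> p - \<phi> q) / (p - q)))) \<longlongrightarrow> - ln (cmod (deriv \<phi> q))) (at q)"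
    by (intro tendsto_intros) auto
  moreover have "eventually (\<lambda>p. - ln (cmod ((\<phi> p - \<phi> q) / (p - q))) =
      ln (cmod (p - q)) - ln (cmod (\<phi> p - \<phi> q))) (at q)"
    using eventually_at_in_open[OF U]
  proof (rule eventually_mono)
    fix p assume p: "p \<in> U - {q}"
    then have "\<phi> p \<noteq> \<phi> q"
      using \<phi>(2) U(2) by (auto dest: inj_onD)
    with p show "- ln (cmod ((\<phi> p - \<phi> q) / (p - q))) =
        ln (cmod (p - q)) - ln (cmod (\<phi> p - \<phi> q))"
      by (simp add: norm_divide ln_div)
  qed
  ultimately show ?thesis
    by (simp add: tendsto_cong)
qed

section \<open>The logarithmic kernel\<close>

text \<open>
  The kernel with the logarithm expanded. It agrees with the logarithm of the quotient for distinct
  points other than \<open>0\<close> and \<open>1\<close>; elsewhere its values, which depend on \<open>ln 0 = 0\<close>, are not used.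
\<close>

definition log_kernel :: "real \<Rightarrow> real \<Rightarrow> complex \<Rightarrow> complex \<Rightarrow> real"
  where "log_kernel k m p q = ln (cmod (p - q))
    - k * (ln (cmod p) + ln (cmod q)) - m * (ln (cmod (p - 1)) + ln (cmod (q - 1)))"

lemma ln_quotient_eq_log_kernel:
  assumes "p \<notin> {0, 1}" "q \<notin> {0, 1}" "p \<noteq> q"
  shows "ln (cmod (p - q) / (cmod (p * q) powr k * cmod ((p - 1) * (q - 1)) powr m))
    = log_kernel k m p q"
proof -
  have "ln (cmod (p * q) powr k * cmod ((p - 1) * (q - 1)) powr m)
      = k * ln (cmod (p * q)) + m * ln (cmod ((p - 1) * (q - 1)))"
    using assms by (simp add: ln_mult ln_powr)
  moreover have "ln (cmod (p * q)) = ln (cmod p) + ln (cmod q)"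
      "ln (cmod ((p - 1) * (q - 1))) = ln (cmod (p - 1)) + ln (cmod (q - 1))"
    using assms by (simp_all add: norm_mult ln_mult)
  ultimately show ?thesis
    using assms by (simp add: log_kernel_def ln_div)
qed

lemma log_kernel_at_top_at_puncture:
  assumes "k > 0" "m > 0" "q \<notin> {0, 1}" "a \<in> {0, 1}"
  shows "filterlim (\<lambda>p. log_kernel k m p q) at_top (at a)"
proof -
  have *: "filterlim (\<lambda>p. g p + - c * ln (cmod (p - a))) at_top (at a)"
    if "(g \<longlongrightarrow> l) (at a)" "c > 0" for g l c
  proof -
    have "filterlim (\<lambda>p. - ln (cmod (p - a))) at_top (at a)"
      using filterlim_ln_cmod_at by (simp add: filterlim_uminus_at_bot)
    then have "filterlim (\<lambda>p. c * - ln (cmod (p - a))) at_top (at a)"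
      using \<open>c > 0\<close> by (rule filterlim_tendsto_pos_mult_at_top[OF tendsto_const, rotated])
    then have "filterlim (\<lambda>p. - c * ln (cmod (p - a))) at_top (at a)"
      by simp
    then show ?thesis
      by (rule filterlim_tendsto_add_at_top[OF that(1)])
  qed
  consider "a = 0" | "a = 1"
    using assms(4) by blast
  then show ?thesis
  proof cases
    case 1
    let ?g = "\<lambda>p. ln (cmod (p - q)) - k * ln (cmod q)
      - m * (ln (cmod (p - 1)) + ln (cmod (q - 1)))"
    have "(?g \<longlongrightarrow> ?g 0) (at 0)"
      using assms(3) by (intro tendsto_intros) auto
    from *[of ?g, unfolded 1, OF this assms(1)] show ?thesis
      unfolding log_kernel_def 1 by (simp add: algebra_simps)
  next
    case 2
    let ?g = "\<lambda>p. ln (cmod (p - q)) - k * (ln (cmod p) + ln (cmod q)) - m * ln (cmod (q - 1))"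
    have "(?g \<longlongrightarrow> ?g 1) (at 1)"
      using assms(3) by (intro tendsto_intros) auto
    from *[of ?g, unfolded 2, OF this assms(2)] show ?thesis
      unfolding log_kernel_def 2 by (simp add: algebra_simps)
  qed
qed

lemma log_kernel_at_top_at_infinity:
  assumes "k + m < 1"
  shows "filterlim (\<lambda>p. log_kernel k m p q) at_top at_infinity"
proof -
  \<comment> \<open>Replacing \<open>p - q\<close> and \<open>p - 1\<close> by \<open>p\<close> costs a bounded term and leaves \<open>(1 - k - m) * ln \<bar>p\<bar>\<close>.\<close>
  let ?g = "\<lambda>p. (ln (cmod (p - q)) - ln (cmod (p - 0)))
    - m * (ln (cmod (p - 1)) - ln (cmod (p - 0))) - k * ln (cmod q) - m * ln (cmod (q - 1))"
  have "(?g \<longlongrightarrow> 0 - m * 0 - k * ln (cmod q) - m * ln (cmod (q - 1))) at_infinity"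
    by (intro tendsto_intros tendsto_ln_cmod_quotient_at_infinity)
  moreover have "filterlim (\<lambda>p. (1 - k - m) * ln (cmod p)) at_top at_infinity"
    using assms
    by (intro filterlim_tendsto_pos_mult_at_top[OF tendsto_const] filterlim_ln_cmod_at_infinity) auto
  ultimately have "filterlim (\<lambda>p. ?g p + (1 - k - m) * ln (cmod p)) at_top at_infinity"
    by (rule filterlim_tendsto_add_at_top)
  moreover have "?g p + (1 - k - m) * ln (cmod p) = log_kernel k m p q" for p
    by (simp add: log_kernel_def algebra_simps)
  ultimately show ?thesis
    by simp
qed

text \<open>
  Here \<open>g\<close> is the inverse of a local coordinate, and \<open>u\<close> the kernel read in that coordinate.
\<close>

lemma log_kernel_harmonic_pullback:
  assumes D: "open D" and g: "g holomorphic_on D"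
    and g_ne: "\<And>z. z \<in> D \<Longrightarrow> g z \<notin> {0, 1, q}"
    and u: "\<And>z. z \<in> D \<Longrightarrow> u z = log_kernel k m (g z) q"
  shows "harmonic_on u D"
proof (rule harmonic_on_Re_derivative[OF D])
  let ?f = "\<lambda>z. deriv g z / (g z - q) - of_real k * (deriv g z / g z)
    - of_real m * (deriv g z / (g z - 1))"
  show "?f holomorphic_on D"
    using g_ne by (intro holomorphic_intros g D) auto
  show "(u has_derivative (\<lambda>h. Re (?f z * h))) (at z)" if z: "z \<in> D" for z
  proof -
    have g': "((\<lambda>z. g z - c) has_field_derivative deriv g z) (at z)" for c
      using holomorphic_derivI[OF g D z] by (auto intro!: derivative_eq_intros)
    have ln': "((\<lambda>z. ln (cmod (g z - c))) has_derivative
        (\<lambda>h. Re (deriv g z / (g z - c) * h))) (at z)" if "c \<in> {0, 1, q}" for c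
      using has_derivative_ln_cmod[OF g'] g_ne[OF z] that by auto
    have "((\<lambda>z. log_kernel k m (g z) q) has_derivative
        (\<lambda>h. Re (deriv g z / (g z - q) * h) - k * (Re (deriv g z / (g z - 0) * h) + 0)
          - m * (Re (deriv g z / (g z - 1) * h) + 0))) (at z)"
      unfolding log_kernel_def
      using ln'[of 0] ln'[of 1] ln'[of q]
      by (intro has_derivative_diff has_derivative_mult_right has_derivative_add
          has_derivative_const) auto
    moreover have "(\<lambda>h. Re (deriv g z / (g z - q) * h) - k * (Re (deriv g z / (g z - 0) * h) + 0)
          - m * (Re (deriv g z / (g z - 1) * h) + 0)) = (\<lambda>h. Re (?f z * h))"
    proof
      fix h
      have "Re (?f z * h) = Re (deriv g z / (g z - q) * h - of_real k * (deriv g z / g z * h)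
          - of_real m * (deriv g z / (g z - 1) * h))"
        by (simp only: left_diff_distrib mult.assoc)
      then show "Re (deriv g z / (g z - q) * h) - k * (Re (deriv g z / (g z - 0) * h) + 0)
          - m * (Re (deriv g z / (g z - 1) * h) + 0) = Re (?f z * h)"
        by (simp only: minus_complex.sel Re_complex_of_real times_complex.sel(1)[of "of_real _"]
            Im_complex_of_real mult_zero_left diff_zero add_0_right)
    qed
    ultimately have "((\<lambda>z. log_kernel k m (g z) q) has_derivative (\<lambda>h. Re (?f z * h))) (at z)"
      by simp
    then show ?thesis
      by (rule has_derivative_transform_within_open[OF _ D z]) (simp add: u)
  qed
qed

lemma log_kernel_bounded_at_pole:
  assumes "open U" "q \<in> U" "\<phi> holomorphic_on U" "inj_on \<phi> U" "q \<notin> {0, 1}"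
  shows "\<exists>B. \<forall>\<^sub>F p in at q. \<bar>log_kernel k m p q - ln (cmod (\<phi> p - \<phi> q))\<bar> \<le> B"
proof -
  let ?r = "\<lambda>p. k * (ln (cmod p) + ln (cmod q)) + m * (ln (cmod (p - 1)) + ln (cmod (q - 1)))"
  have "(?r \<longlongrightarrow> ?r q) (at q)"
    using assms(5) by (intro tendsto_intros) auto
  from tendsto_diff[OF tendsto_ln_cmod_diff_coordinate[OF assms(1-4)] this]
  have "((\<lambda>p. log_kernel k m p q - ln (cmod (\<phi> p - \<phi> q))) \<longlongrightarrow> - ln (cmod (deriv \<phi> q)) - ?r q) (at q)"
    by (simp add: log_kernel_def algebra_simps)
  then show ?thesis
    using tendsto_imp_eventually_bounded by blast
qed

lemma log_kernel_diff_bounded_at_boundary: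
  assumes "q \<notin> {0, 1}" "q' \<notin> {0, 1}"
  shows "\<exists>B. \<forall>\<^sub>F p in ideal_boundary (top_of_set (UNIV - {0, 1})).
    \<bar>log_kernel k m p q - log_kernel k m p q'\<bar> \<le> B"
proof -
  let ?c = "k * (ln (cmod q') - ln (cmod q)) + m * (ln (cmod (q' - 1)) - ln (cmod (q - 1)))"
  let ?d = "\<lambda>p. ln (cmod (p - q)) - ln (cmod (p - q'))"
  have *: "\<exists>B. eventually (\<lambda>p. \<bar>?d p\<bar> \<le> B) (at a)" if "a \<in> {0, 1}" for a
  proof -
    have "(?d \<longlongrightarrow> ?d a) (at a)"
      using assms that by (intro tendsto_intros) auto
    then show ?thesis
      using tendsto_imp_eventually_bounded by blast
  qed
  obtain B0 B1 B2 where B: "eventually (\<lambda>p. \<bar>?d p\<bar> \<le> B0) (at 0)"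
      "eventually (\<lambda>p. \<bar>?d p\<bar> \<le> B1) (at 1)" "eventually (\<lambda>p. \<bar>?d p\<bar> \<le> B2) at_infinity"
    using *[of 0] *[of 1] tendsto_imp_eventually_bounded[OF tendsto_ln_cmod_quotient_at_infinity]
    by blast
  define B where "B = max B0 (max B1 B2)"
  have "eventually (\<lambda>p. \<bar>?d p\<bar> \<le> B) (ideal_boundary (top_of_set (UNIV - {0, 1})))"
    by (rule eventually_ideal_boundary_plane_domain)
      (auto simp: B_def intro: eventually_mono[OF B(1)] eventually_mono[OF B(2)]
        eventually_mono[OF B(3)])
  then have "eventually (\<lambda>p. \<bar>log_kernel k m p q - log_kernel k m p q'\<bar> \<le> B + \<bar>?c\<bar>)
      (ideal_boundary (top_of_set (UNIV - {0, 1})))"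
  proof (rule eventually_mono)
    fix p assume "\<bar>?d p\<bar> \<le> B"
    moreover have "log_kernel k m p q - log_kernel k m p q' = ?d p + ?c"
      by (simp add: log_kernel_def algebra_simps)
    ultimately show "\<bar>log_kernel k m p q - log_kernel k m p q'\<bar> \<le> B + \<bar>?c\<bar>"
      by linarith
  qed
  then show ?thesis
    by blast
qed

theorem theorem1p7:
  fixes k m :: real
  assumes "k > 0" and "m > 0" and "k + m < 1"
  shows "evans_kernel (top_of_set (UNIV - {0, 1})) (plane_atlas (UNIV - {0, 1}))
    (\<lambda>p q. ln (cmod (p - q) / (cmod (p * q) powr k * cmod ((p - 1) * (q - 1)) powr m)))"
proof -
  define S where "S = UNIV - {0, 1::complex}"
  define E where "E = (\<lambda>p q. ln (cmod (p - q) /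
    (cmod (p * q) powr k * cmod ((p - 1) * (q - 1)) powr m)))"
  let ?X = "top_of_set S" and ?A = "plane_atlas S"
  have E_eq: "E p q = log_kernel k m p q" if "p \<in> S" "q \<in> S" "p \<noteq> q" for p q
    using ln_quotient_eq_log_kernel that by (simp add: E_def S_def)
  have S: "open S"
    unfolding S_def by (intro open_Diff) auto
  have "connected S"
    unfolding S_def by (intro connected_open_delete_finite) auto
  moreover have "2 \<in> S"
    by (simp add: S_def)
  ultimately have ors: "open_riemann_surface ?X ?A"
    using S open_riemann_surface_plane_domain by blast
  \<comment> \<open>Near the ideal boundary the kernel and its expanded form agree.\<close>
  have ev_S: "eventually (\<lambda>p. p \<in> S \<and> p \<noteq> q) (ideal_boundary ?X)" for q
    unfolding S_def
  proof (rule eventually_ideal_boundary_plane_domain)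
    show "eventually (\<lambda>p. p \<in> UNIV - {0, 1} \<and> p \<noteq> q) at_infinity"
      using eventually_conj[OF eventually_not_equal_at_infinity[of 0]
          eventually_conj[OF eventually_not_equal_at_infinity[of 1]
            eventually_not_equal_at_infinity[of q]]]
      by simp
    show "eventually (\<lambda>p. p \<in> UNIV - {0, 1} \<and> p \<noteq> q) (at a)" for a
      by (auto intro!: eventually_conj eventually_neq_at_within)
  qed
  have pot: "evans_selberg_potential ?X ?A q (\<lambda>p. E p q)" if q: "q \<in> S" for q
    unfolding evans_selberg_potential_def
  proof (intro conjI allI impI)
    show "surface_harmonic_on ?X ?A (\<lambda>p. E p q) (topspace ?X - {q})"
      unfolding surface_harmonic_on_def
    proof (intro conjI allI impI)
      show "openin ?X (topspace ?X - {q})"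
        using S by (simp add: openin_open_eq open_delete)
      fix U \<phi> assume "local_coordinate ?X ?A U \<phi>"
      note U = local_coordinate_plane_domain[OF S this]
      let ?D = "\<phi> ` (U \<inter> (topspace ?X - {q}))"
      have D: "?D = \<phi> ` (U - {q})"
        using U(2) by auto
      have inv: "inv_into U \<phi> z \<in> S - {q}" if "z \<in> ?D" for z
        using that U(2,3) by auto
      have "open ?D"
        unfolding D using U
        by (intro open_mapping_thm3[OF holomorphic_on_subset[OF U(4)]])
          (auto intro: inj_on_subset open_delete)
      then show "harmonic_on (\<lambda>z. E (inv_into U \<phi> z) q) ?D"
      proof (rule log_kernel_harmonic_pullback)
        show "inv_into U \<phi> holomorphic_on ?D"
          using U(6) by (rule holomorphic_on_subset) auto
        show "inv_into U \<phi> z \<notin> {0, 1, q}" if "z \<in> ?D" for z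
          using inv[OF that] by (auto simp: S_def)
        show "E (inv_into U \<phi> z) q = log_kernel k m (inv_into U \<phi> z) q" if "z \<in> ?D" for z
          using inv[OF that] q by (auto intro: E_eq)
      qed
    qed
  next
    fix U \<phi> assume "local_coordinate ?X ?A U \<phi> \<and> q \<in> U"
    then have loc: "local_coordinate ?X ?A U \<phi>" and qU: "q \<in> U"
      by auto
    note U = local_coordinate_plane_domain[OF S loc]
    obtain B where "\<forall>\<^sub>F p in at q. \<bar>log_kernel k m p q - ln (cmod (\<phi> p - \<phi> q))\<bar> \<le> B"
      using log_kernel_bounded_at_pole[OF U(1) qU U(4,3)] q by (auto simp: S_def)
    moreover have "\<forall>\<^sub>F p in at q. p \<in> S - {q}"
      using S q by (rule eventually_at_in_open)
    ultimately have "\<forall>\<^sub>F p in at q. \<bar>E p q - ln (cmod (\<phi> p - \<phi> q))\<bar> \<le> B"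
      by eventually_elim (use q E_eq in auto)
    then show "\<exists>B. \<forall>\<^sub>F p in atin ?X q. \<bar>E p q - ln (cmod (\<phi> p - \<phi> q))\<bar> \<le> B"
      using atin_top_of_set_open[OF S q] by auto
  next
    have q': "q \<notin> {0, 1}"
      using q by (simp add: S_def)
    have "filterlim (\<lambda>p. log_kernel k m p q) at_top (ideal_boundary ?X)"
      unfolding filterlim_at_top S_def
      using log_kernel_at_top_at_puncture[OF assms(1,2) q']
        log_kernel_at_top_at_infinity[OF assms(3), of q]
      by (auto intro!: eventually_ideal_boundary_plane_domain simp: filterlim_at_top)
    moreover have "\<forall>\<^sub>F p in ideal_boundary ?X. log_kernel k m p q = E p q"
      using ev_S[of q] by eventually_elim (use q E_eq in auto)
    ultimately show "filterlim (\<lambda>p. E p q) at_top (ideal_boundary ?X)"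
      by (rule filterlim_mono_eventually[OF _ order_refl order_refl])
  qed (use ors q in auto)
  have diff: "\<exists>B. \<forall>\<^sub>F p in ideal_boundary ?X. \<bar>E p q - E p q'\<bar> \<le> B" if qs: "q \<in> S" "q' \<in> S" for q q'
  proof -
    obtain B where "\<forall>\<^sub>F p in ideal_boundary ?X. \<bar>log_kernel k m p q - log_kernel k m p q'\<bar> \<le> B"
      using log_kernel_diff_bounded_at_boundary[of q q' k m] qs unfolding S_def by blast
    with ev_S[of q] ev_S[of q'] have "\<forall>\<^sub>F p in ideal_boundary ?X. \<bar>E p q - E p q'\<bar> \<le> B"
      by eventually_elim (use qs E_eq in auto)
    then show ?thesis ..
  qed
  have sym: "E p q = E q p" for p q
    by (simp add: E_def mult.commute norm_minus_commute)
  have "evans_kernel ?X ?A E"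
    unfolding evans_kernel_def using ors pot diff sym by auto
  then show ?thesis
    unfolding S_def E_def .
qed

end
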